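(* Let $\alpha>-\frac12$ and let $f,g\in L^1_\alpha(\mathbb{R})$. Then $$\int_{\mathbb{R}}\mathcal{F}_{B,S}^\alpha(f)(x)\,g(x)\,d\mu_\alpha(x)=\int_{\mathbb{R}}\mathcal{F}_{B,S}^\alpha(g)(x)\,f(x)\,d\mu_\alpha(x).$$
   Context: For $\alpha>-\frac12$, $\lambda\in\mathbb{C}$ and $x\in\mathbb{R}$, the Bessel-Struve kernel is $S_\lambda^\alpha(x)=j_\alpha(i\lambda x)-i\,h_\alpha(i\lambda x)$, where $j_\alpha(z)=\Gamma(\alpha+1)\sum_{n\ge0}\frac{(-1)^n(z/2)^{2n}}{n!\,\Gamma(n+\alpha+1)}$ and $h_\alpha(z)=\Gamma(\alpha+1)\sum_{n\ge0}\frac{(-1)^n(z/2)^{2n+1}}{\Gamma(n+\frac32)\Gamma(n+\alpha+\frac32)}$. Equivalently, $S_\lambda^\alpha(x)=\frac{2\Gamma(\alpha+1)}{\sqrt\pi\,\Gamma(\alpha+\frac12)}\int_0^1(1-t^2)^{\alpha-\frac12}e^{\lambda xt}\,dt$. $L^1_\alpha(\mathbb{R})$ is the space of real-valued measurable functions $f$ on $\mathbb{R}$ with $\int_{\mathbb{R}}|f(x)|\,d\mu_\alpha(x)<+\infty$, where $d\mu_\alpha(x)=|x|^{2\alpha+1}dx$. The Bessel-Struve transform of $f\in L^1_\alpha(\mathbb{R})$ is $\mathcal{F}_{B,S}^\alpha(f)(\lambda)=\int_{\mathbb{R}}f(x)\,S_{-i\lambda}^\alpha(x)\,d\mu_\alpha(x)$,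 $\lambda\in\mathbb{R}$. *)

theory Defs
  imports "HOL-Analysis.Analysis"
begin

definition bessel_j :: "real \<Rightarrow> complex \<Rightarrow> complex" where
  "bessel_j \<alpha> z = of_real (Gamma (\<alpha> + 1)) *
     (\<Sum>n. (-1) ^ n * (z / 2) ^ (2 * n) / (fact n * of_real (Gamma (real n + \<alpha> + 1))))"

definition struve_h :: "real \<Rightarrow> complex \<Rightarrow> complex" where
  "struve_h \<alpha> z = of_real (Gamma (\<alpha> + 1)) *
     (\<Sum>n. (-1) ^ n * (z / 2) ^ (2 * n + 1) /
       of_real (Gamma (real n + 3 / 2) * Gamma (real n + \<alpha> + 3 / 2)))"

definition bessel_struve_kernel :: "real \<Rightarrow> complex \<Rightarrow> real \<Rightarrow> complex" where
  "bessel_struve_kernel \<alpha> \<xi> x =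
     bessel_j \<alpha> (\<i> * \<xi> * of_real x) - \<i> * struve_h \<alpha> (\<i> * \<xi> * of_real x)"

(* Based on Lebesgue rather than Borel measure, so that "measurable" below means
   Lebesgue measurable. *)
definition bessel_struve_measure :: "real \<Rightarrow> real measure" where
  "bessel_struve_measure \<alpha> = density lebesgue (\<lambda>x. ennreal (\<bar>x\<bar> powr (2 * \<alpha> + 1)))"

(* Functions, not classes modulo equality almost everywhere. *)
definition bessel_struve_L1 :: "real \<Rightarrow> (real \<Rightarrow> real) set" where
  "bessel_struve_L1 \<alpha> = {f. integrable (bessel_struve_measure \<alpha>) f}"

definition bessel_struve_transform :: "real \<Rightarrow> (real \<Rightarrow> real) \<Rightarrow> real \<Rightarrow> complex" where
  "bessel_struve_transform \<alpha> f \<xi> =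
     (\<integral>x. of_real (f x) * bessel_struve_kernel \<alpha> (- \<i> * of_real \<xi>) x
        \<partial>bessel_struve_measure \<alpha>)"

end

theory Submission
  imports Defs
begin

text \<open>
  The kernel \<open>S\<^sub>-\<^sub>i\<^sub>x(y)\<close> depends only on the product \<open>xy\<close>, so the identity is Fubini's
  theorem once the kernel is known to be bounded and measurable. Both follow from the representation
  of the kernel as a constant times
  \<open>\<integral>\<^sub>0\<^sup>1 u\<^sup>-\<^sup>1\<^sup>/\<^sup>2 (1 - u)\<^sup>\<alpha>\<^sup>-\<^sup>1\<^sup>/\<^sup>2 exp(-i s \<surd>u) du\<close> with \<open>s = xy\<close> (the integral of the
  paper with \<open>u = t\<^sup>2\<close>). Expanding the exponential and integrating termwise yields Beta
  values, which the duplication formula turns into the coefficients of the two defining series.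
\<close>

section \<open>Duplication formula and factorials\<close>

lemma Gamma_legendre_duplication_real:
  fixes x :: real
  assumes "x > 0"
  shows "Gamma x * Gamma (x + 1/2) = exp ((1 - 2*x) * ln 2) * sqrt pi * Gamma (2*x)"
proof -
  have "complex_of_real x \<notin> \<int>\<^sub>\<le>\<^sub>0" "complex_of_real (x + 1/2) \<notin> \<int>\<^sub>\<le>\<^sub>0"
    using assms by (auto simp only: of_real_in_nonpos_Ints_iff dest: nonpos_Ints_nonpos)
  then have "Gamma (complex_of_real x) * Gamma (complex_of_real (x + 1/2)) =
      of_real (exp ((1 - 2*x) * ln 2)) * of_real (sqrt pi) * Gamma (complex_of_real (2*x))"
    using Gamma_legendre_duplication[of "complex_of_real x"] by (simp add: exp_of_real[symmetric])
  then have "complex_of_real (Gamma x * Gamma (x + 1/2)) =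
      complex_of_real (exp ((1 - 2*x) * ln 2) * sqrt pi * Gamma (2*x))"
    unfolding Gamma_complex_of_real by simp
  then show ?thesis
    unfolding of_real_eq_iff .
qed

text \<open>Duplication at \<open>(real n + 1) / 2\<close>, where \<open>Gamma (2*x)\<close> is a
  factorial. Of the two Gamma factors, one will cancel against a Beta value and the other stays in
  the series coefficients.\<close>

lemma fact_conv_Gamma_half:
  "fact n * sqrt pi = 2 ^ n * Gamma ((real n + 1) / 2) * Gamma (real n / 2 + 1)"
proof -
  have "Gamma ((real n + 1) / 2) * Gamma (real n / 2 + 1) = exp (- real n * ln 2) * sqrt pi * fact n"
    using Gamma_legendre_duplication_real[of "(real n + 1) / 2"]
    by (simp add: Gamma_fact add_divide_distrib algebra_simps)
  then have "2 ^ n * (Gamma ((real n + 1) / 2) * Gamma (real n / 2 + 1))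
      = 2 ^ n * exp (- real n * ln 2) * (sqrt pi * fact n)"
    by simp
  also have "2 ^ n * exp (- real n * ln 2) = 1"
    by (simp add: exp_minus exp_of_nat_mult)
  finally show ?thesis
    by (simp add: mult_ac)
qed

section \<open>Beta weights and termwise integration\<close>

definition beta_weight :: "real \<Rightarrow> real \<Rightarrow> real \<Rightarrow> real" where
  "beta_weight a b u = indicator {0..1} u * (u powr (a - 1) * (1 - u) powr (b - 1))"

lemma beta_weight_nonneg: "beta_weight a b u \<ge> 0"
  by (simp add: beta_weight_def)

lemma borel_measurable_beta_weight [measurable]: "beta_weight a b \<in> borel_measurable borel"
  unfolding beta_weight_def by measurable

lemma has_bochner_integral_beta_weight:
  assumes "a > 0" "b > 0"
  shows "has_bochner_integral lborel (beta_weight a b) (Beta a b)"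
proof -
  have "integrable lborel (beta_weight a b)"
    using integrable_Beta[OF assms] unfolding set_integrable_def beta_weight_def by simp
  moreover have "integral\<^sup>L lborel (beta_weight a b) = Beta a b"
    using set_borel_integral_eq_integral(2)[OF integrable_Beta[OF assms]]
      integral_unique[OF has_integral_Beta_real[OF assms]]
    unfolding set_lebesgue_integral_def beta_weight_def by simp
  ultimately show ?thesis
    by (simp add: has_bochner_integral_iff)
qed

text \<open>On [0,1] a power of \<open>u\<close> decreases as its exponent grows, so the weights
  compare pointwise. This bounds all Beta values of the exponential expansion by the first
  one.\<close>

lemma Beta_mono_left:
  fixes a a' b :: real
  assumes "0 < a" "a \<le> a'" "0 < b"
  shows "Beta a' b \<le> Beta a b"
proof -
  have le: "beta_weight a' b u \<le> beta_weight a b u" for u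
  proof (cases "u \<in> {0..1}")
    case True
    then have "u powr (a' - 1) \<le> u powr (a - 1)"
      using assms by (intro powr_mono') auto
    then show ?thesis
      unfolding beta_weight_def by (intro mult_left_mono mult_right_mono) auto
  qed (simp add: beta_weight_def)
  have W: "has_bochner_integral lborel (beta_weight a' b) (Beta a' b)"
      "has_bochner_integral lborel (beta_weight a b) (Beta a b)"
    using assms by (intro has_bochner_integral_beta_weight; linarith)+
  have "integral\<^sup>L lborel (beta_weight a' b) \<le> integral\<^sup>L lborel (beta_weight a b)"
    by (rule integral_mono[OF W[THEN integrable.intros] le])
  then show ?thesis
    unfolding W[THEN has_bochner_integral_integral_eq] .
qed

lemma beta_weight_sqrt_power:
  "beta_weight a b u * sqrt u ^ n = beta_weight (a + real n / 2) b u"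
proof (cases "u > 0")
  case True
  have "sqrt u ^ n = u powr (real n / 2)"
    using True by (simp add: powr_half_sqrt[symmetric] powr_powr flip: powr_realpow)
  then show ?thesis
    by (simp add: beta_weight_def algebra_simps flip: powr_add)
\<comment> \<open>Both sides vanish here: for \<open>u < 0\<close> by the indicator, at
  \<open>u = 0\<close> because \<open>0 powr x = 0\<close> for every \<open>x\<close>, including
  \<open>x = 0\<close>.\<close>
qed (auto simp: beta_weight_def indicator_def)

text \<open>Each power of \<open>sqrt u\<close> from the exponential series raises the first Beta
  parameter by one half. Sum and integral may be exchanged because the integrals of the norms are
  summable.\<close>

lemma exp_sqrt_series_integral:
  fixes a b :: real and z :: complex
  assumes "a > 0" "b > 0"
  shows "(\<lambda>n. z ^ n / fact n * of_real (Beta (a + real n / 2) b)) sums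
           (\<integral>u. of_real (beta_weight a b u) * exp (z * of_real (sqrt u)) \<partial>lborel)"
proof -
  define f where "f n u = z ^ n / fact n * of_real (beta_weight (a + real n / 2) b u)" for n u
  have W: "has_bochner_integral lborel (beta_weight (a + real n / 2) b) (Beta (a + real n / 2) b)" for n
    using assms by (intro has_bochner_integral_beta_weight) auto
  have f: "has_bochner_integral lborel (f n) (z ^ n / fact n * of_real (Beta (a + real n / 2) b))" for n
    unfolding f_def by (intro has_bochner_integral_mult_right has_bochner_integral_of_real W)
  have norm_f: "norm (f n u) = norm z ^ n / fact n * beta_weight (a + real n / 2) b u" for n u
    by (simp add: f_def norm_mult norm_divide norm_power beta_weight_nonneg)
  have sums_f: "(\<lambda>n. f n u) sums (of_real (beta_weight a b u) * exp (z * of_real (sqrt u)))" for u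
  proof -
    have "f n u = of_real (beta_weight a b u) * ((z * of_real (sqrt u)) ^ n /\<^sub>R fact n)" for n
      unfolding f_def beta_weight_sqrt_power[symmetric]
      by (simp add: power_mult_distrib scaleR_conv_of_real divide_inverse mult_ac)
    then show ?thesis
      by (simp only:) (intro sums_mult exp_converges)
  qed
  have "(\<lambda>n. integral\<^sup>L lborel (f n)) sums (\<integral>u. (\<Sum>n. f n u) \<partial>lborel)"
  proof (rule sums_integral)
    show "integrable lborel (f n)" for n
      using f has_bochner_integral_iff by blast
    have "summable (\<lambda>n. norm (f n u))" for u
    proof -
      have "norm (f n u) = beta_weight a b u * ((norm z * sqrt u) ^ n /\<^sub>R fact n)" for n
        unfolding norm_f beta_weight_sqrt_power[symmetric]
        by (simp add: power_mult_distrib divide_inverse mult_ac)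
      then show ?thesis
        by (simp only:) (intro summable_mult summable_exp_generic)
    qed
    then show "AE u in lborel. summable (\<lambda>n. norm (f n u))"
      by simp
    have norm_integral:
      "(\<integral>u. norm (f n u) \<partial>lborel) = norm z ^ n / fact n * Beta (a + real n / 2) b" for n
      unfolding norm_f by (intro has_bochner_integral_integral_eq has_bochner_integral_mult_right W)
    show "summable (\<lambda>n. \<integral>u. norm (f n u) \<partial>lborel)"
    proof (rule summable_comparison_test')
      \<comment> \<open>Replacing each Beta value by the largest, \<open>Beta a b\<close>, leaves an
        exponential series as majorant.\<close>
      show "summable (\<lambda>n. norm z ^ n / fact n * Beta a b)"
        using summable_exp_generic[of "norm z"]
        by (intro summable_mult2) (simp add: divide_inverse mult.commute)
      show "norm (\<integral>u. norm (f n u) \<partial>lborel) \<le> norm z ^ n / fact n * Beta a b" for n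
      proof -
        have "Beta (a + real n / 2) b \<le> Beta a b"
          using assms by (intro Beta_mono_left) auto
        then have "norm z ^ n / fact n * Beta (a + real n / 2) b \<le> norm z ^ n / fact n * Beta a b"
          by (intro mult_left_mono) auto
        moreover have "0 \<le> (\<integral>u. norm (f n u) \<partial>lborel)"
          by (rule integral_nonneg_AE) simp
        ultimately show ?thesis
          unfolding norm_integral real_norm_def by (simp only: abs_of_nonneg)
      qed
    qed
  qed
  moreover have "integral\<^sup>L lborel (f n) = z ^ n / fact n * of_real (Beta (a + real n / 2) b)" for n
    using f by (rule has_bochner_integral_integral_eq)
  moreover have "(\<Sum>n. f n u) = of_real (beta_weight a b u) * exp (z * of_real (sqrt u))" for u
    using sums_f by (rule sums_unique[symmetric])
  ultimately show ?thesis
    by (simp only:)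
qed

section \<open>Integral representation of the kernel\<close>

definition bessel_struve_integral :: "real \<Rightarrow> real \<Rightarrow> complex" where
  "bessel_struve_integral \<alpha> s =
     (\<integral>u. of_real (beta_weight (1/2) (\<alpha> + 1/2) u) * exp (- \<i> * of_real s * of_real (sqrt u)) \<partial>lborel)"

lemma borel_measurable_bessel_struve_integral [measurable]:
  "bessel_struve_integral \<alpha> \<in> borel_measurable borel"
  unfolding bessel_struve_integral_def by measurable

text \<open>For real \<open>s\<close> the exponential has modulus one, so the integrand is dominated
  by the weight, uniformly in \<open>s\<close>.\<close>

lemma norm_bessel_struve_integral_le:
  assumes "\<alpha> > - 1 / 2"
  shows "norm (bessel_struve_integral \<alpha> s) \<le> Beta (1/2) (\<alpha> + 1/2)"
proof -
  have W: "has_bochner_integral lborel (beta_weight (1/2) (\<alpha> + 1/2)) (Beta (1/2) (\<alpha> + 1/2))"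
    using assms by (intro has_bochner_integral_beta_weight) auto
  have "norm (bessel_struve_integral \<alpha> s) \<le> (\<integral>u. beta_weight (1/2) (\<alpha> + 1/2) u \<partial>lborel)"
    unfolding bessel_struve_integral_def
  proof (rule Bochner_Integration.integral_norm_bound_integral)
    show *: "integrable lborel (beta_weight (1/2) (\<alpha> + 1/2))"
      using W has_bochner_integral_iff by blast
    show "norm (of_real (beta_weight (1/2) (\<alpha> + 1/2) u) * exp (- \<i> * of_real s * of_real (sqrt u)))
        \<le> beta_weight (1/2) (\<alpha> + 1/2) u" for u
      by (simp add: norm_mult beta_weight_nonneg)
    then show "integrable lborel (\<lambda>u. of_real (beta_weight (1/2) (\<alpha> + 1/2) u) *
        exp (- \<i> * of_real s * of_real (sqrt u)))"
      by (intro Bochner_Integration.integrable_bound[OF *]) (auto simp: beta_weight_nonneg)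
  qed
  then show ?thesis
    using W by (simp add: has_bochner_integral_iff)
qed

text \<open>A single series for both functions: up to the factor
  \<open>Gamma (\<alpha> + 1)\<close>, its even terms are those of the Bessel part and its odd terms
  those of the Struve part.\<close>

lemma bessel_struve_integral_series:
  assumes "\<alpha> > - 1 / 2"
  shows "(\<lambda>n. (- \<i> * of_real s / 2) ^ n /
             of_real (Gamma (real n / 2 + 1) * Gamma (real n / 2 + \<alpha> + 1))) sums
           (bessel_struve_integral \<alpha> s / of_real (sqrt pi * Gamma (\<alpha> + 1/2)))"
proof -
  let ?G = "sqrt pi * Gamma (\<alpha> + 1/2)"
  have G: "Gamma (\<alpha> + 1/2) > 0"
    using assms by (intro Gamma_real_pos) simp
  have coeff: "Beta (1/2 + real n / 2) (\<alpha> + 1/2) / (fact n * ?G) =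
      1 / (2 ^ n * (Gamma (real n / 2 + 1) * Gamma (real n / 2 + \<alpha> + 1)))" for n
  proof -
    have pos: "Gamma (real n / 2 + \<alpha> + 1) > 0" "Gamma (real n / 2 + 1) > 0" "Gamma ((real n + 1) / 2) > 0"
      using assms by (auto intro!: Gamma_real_pos)
    have "Beta (1/2 + real n / 2) (\<alpha> + 1/2) =
        Gamma ((real n + 1) / 2) * Gamma (\<alpha> + 1/2) / Gamma (real n / 2 + \<alpha> + 1)"
      by (simp add: Beta_def add_divide_distrib algebra_simps)
    moreover have "fact n * ?G =
        2 ^ n * Gamma ((real n + 1) / 2) * Gamma (real n / 2 + 1) * Gamma (\<alpha> + 1/2)"
      using fact_conv_Gamma_half[of n] by (simp add: mult_ac)
    \<comment> \<open>The cancellation with \<open>x\<close>, \<open>y\<close>, \<open>z\<close>,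
      \<open>g\<close> for the Gamma values at \<open>(real n + 1) / 2\<close>,
      \<open>real n / 2 + 1\<close>, \<open>real n / 2 + \<alpha> + 1\<close>,
      \<open>\<alpha> + 1/2\<close>, and \<open>p\<close> for \<open>2 ^ n\<close>.\<close>
    moreover have "x * g / z / (p * x * y * g) = 1 / (p * (y * z))"
      if "x > 0" "y > 0" "z > 0" "g > 0" "p > 0" for x y z g p :: real
      using that by (simp add: field_simps)
    ultimately show ?thesis
      using pos G by (simp only: zero_less_power zero_less_numeral)
  qed
  have "(\<lambda>n. (- \<i> * of_real s) ^ n / fact n * of_real (Beta (1/2 + real n / 2) (\<alpha> + 1/2)) / of_real ?G)
      sums (bessel_struve_integral \<alpha> s / of_real ?G)"
    unfolding bessel_struve_integral_def using assms by (intro sums_divide exp_sqrt_series_integral) auto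
  moreover have "(- \<i> * of_real s) ^ n / fact n * of_real (Beta (1/2 + real n / 2) (\<alpha> + 1/2)) / of_real ?G
      = (- \<i> * of_real s / 2) ^ n / of_real (Gamma (real n / 2 + 1) * Gamma (real n / 2 + \<alpha> + 1))" for n
  proof -
    have "(- \<i> * of_real s) ^ n / fact n * of_real (Beta (1/2 + real n / 2) (\<alpha> + 1/2)) / of_real ?G
        = (- \<i> * of_real s) ^ n * complex_of_real (Beta (1/2 + real n / 2) (\<alpha> + 1/2) / (fact n * ?G))"
      by simp
    then show ?thesis
      unfolding coeff power_divide[of "- \<i> * of_real s"] by simp
  qed
  ultimately show ?thesis
    by simp
qed

text \<open>
  The even terms of the series are real and the odd ones purely imaginary, so taking real and
  imaginary parts separates the Bessel from the Struve part.
\<close>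
lemma bessel_struve_kernel_conv_integral:
  assumes "\<alpha> > - 1 / 2"
  shows "bessel_j \<alpha> (of_real s) - \<i> * struve_h \<alpha> (of_real s) =
    of_real (Gamma (\<alpha> + 1) / (sqrt pi * Gamma (\<alpha> + 1/2))) * bessel_struve_integral \<alpha> s"
proof -
  define I where "I = bessel_struve_integral \<alpha> s / of_real (sqrt pi * Gamma (\<alpha> + 1/2))"
  define a where "a n = (-1) ^ n * (s/2) ^ (2*n) / (fact n * Gamma (real n + \<alpha> + 1))" for n
  define b where "b n = (-1) ^ n * (s/2) ^ (2*n+1) / (Gamma (real n + 3/2) * Gamma (real n + \<alpha> + 3/2))" for n
  define T where "T n = (- \<i> * of_real s / 2) ^ n /
      of_real (Gamma (real n / 2 + 1) * Gamma (real n / 2 + \<alpha> + 1))" for n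
  \<comment> \<open>Squaring \<open>- \<i>\<close> gives -1, the source of the alternating sign in
    both series.\<close>
  have sq: "(- \<i> * of_real s / 2) ^ (2*n) = of_real ((-1) ^ n * (s/2) ^ (2*n))" for n
  proof -
    have "(- \<i> * of_real s / 2)\<^sup>2 = complex_of_real (- 1 * (s/2)\<^sup>2)"
      by (simp add: power_divide power_mult_distrib)
    then show ?thesis
      by (simp only: power_mult power_mult_distrib[symmetric] of_real_power)
  qed
  have even: "T (2*n) = of_real (a n)" for n
    unfolding T_def a_def sq by (simp add: Gamma_fact add_ac)
  have odd: "T (2*n+1) = - \<i> * of_real (b n)" for n
  proof -
    have "real (2*n+1) / 2 + 1 = real n + 3/2" "real (2*n+1) / 2 + \<alpha> + 1 = real n + \<alpha> + 3/2"
      by (simp_all add: field_simps)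
    moreover have "(- \<i> * of_real s / 2) ^ (2*n+1) = - \<i> * of_real ((-1) ^ n * (s/2) ^ (2*n+1))"
      unfolding power_add sq by simp
    ultimately have "T (2*n+1) = - \<i> * of_real ((-1) ^ n * (s/2) ^ (2*n+1)) /
        of_real (Gamma (real n + 3/2) * Gamma (real n + \<alpha> + 3/2))"
      unfolding T_def by (simp only:)
    then show ?thesis
      unfolding b_def by simp
  qed
  have "T sums I"
    unfolding T_def I_def using assms by (rule bessel_struve_integral_series)
  \<comment> \<open>Grouping in pairs preserves the sum and puts one Bessel and one Struve term into
    each block.\<close>
  then have "(\<lambda>n. sum T {n * 2..<n * 2 + 2}) sums I"
    by (rule sums_group) simp
  moreover have "sum T {n * 2..<n * 2 + 2} = of_real (a n) + - \<i> * of_real (b n)" for n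
  proof -
    have "{n * 2..<n * 2 + 2} = {2*n, 2*n+1}"
      by auto
    then have "sum T {n * 2..<n * 2 + 2} = T (2*n) + T (2*n+1)"
      by simp
    then show ?thesis
      unfolding even odd .
  qed
  ultimately have sums: "(\<lambda>n. of_real (a n) + - \<i> * of_real (b n)) sums I"
    by (simp only:)
  have "(\<lambda>n. complex_of_real (a n)) sums of_real (Re I)"
    using sums_of_real[OF sums_Re[OF sums]] by simp
  then have j: "bessel_j \<alpha> (of_real s) = of_real (Gamma (\<alpha> + 1)) * of_real (Re I)"
    by (simp add: bessel_j_def a_def sums_iff)
  \<comment> \<open>The odd terms carry the factor \<open>- \<i>\<close>, hence the minus
    sign.\<close>
  have "(\<lambda>n. complex_of_real (b n)) sums of_real (- Im I)"
    using sums_of_real[OF sums_minus[OF sums_Im[OF sums]]] by simp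
  then have h: "struve_h \<alpha> (of_real s) = of_real (Gamma (\<alpha> + 1)) * of_real (- Im I)"
    by (simp add: struve_h_def b_def sums_iff)
  have "bessel_j \<alpha> (of_real s) - \<i> * struve_h \<alpha> (of_real s) =
      of_real (Gamma (\<alpha> + 1)) * (of_real (Re I) + \<i> * of_real (Im I))"
    unfolding j h by (simp add: algebra_simps)
  also have "of_real (Re I) + \<i> * of_real (Im I) = I"
    by (rule complex_eq[symmetric])
  finally show ?thesis
    by (simp add: I_def)
qed

text \<open>Packages what Fubini's theorem needs. The argument of both series is real, since
  \<open>\<i> * (- \<i> * x) * y = x * y\<close>, so the integral representation applies with
  \<open>s = x * y\<close>.\<close>

lemma bessel_struve_kernel_bounded_measurable:
  assumes "\<alpha> > - 1 / 2"
  obtains K B where "K \<in> borel_measurable borel" "\<And>s. norm (K s) \<le> B"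
    "\<And>x y. bessel_struve_kernel \<alpha> (- \<i> * of_real x) y = K (x * y)"
proof
  let ?C = "Gamma (\<alpha> + 1) / (sqrt pi * Gamma (\<alpha> + 1/2))"
  let ?K = "\<lambda>s. of_real ?C * bessel_struve_integral \<alpha> s"
  show "?K \<in> borel_measurable borel"
    by measurable
  show "norm (?K s) \<le> \<bar>?C\<bar> * Beta (1/2) (\<alpha> + 1/2)" for s
    unfolding norm_mult norm_of_real
    using assms by (intro mult_left_mono norm_bessel_struve_integral_le) auto
  show "bessel_struve_kernel \<alpha> (- \<i> * of_real x) y = ?K (x * y)" for x y
  proof -
    have "\<i> * (- \<i> * complex_of_real x) * of_real y = of_real (x * y)"
      by simp
    then show ?thesis
      unfolding bessel_struve_kernel_def bessel_struve_kernel_conv_integral[OF assms, symmetric]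
      by (simp only:)
  qed
qed

section \<open>Sigma-finiteness and Fubini\<close>

text \<open>The same countable cover serves: sets of \<open>M\<close> stay measurable in the
  completion and keep their measure. Applied to \<open>lebesgue\<close>, the completion of
  \<open>lborel\<close>.\<close>

lemma sigma_finite_completion:
  assumes "sigma_finite_measure M"
  shows "sigma_finite_measure (completion M)"
proof
  from sigma_finite_measure.sigma_finite_countable[OF assms] obtain A
    where "countable A" "A \<subseteq> sets M" "\<Union>A = space M" "\<forall>a\<in>A. emeasure M a \<noteq> \<infinity>"
    by blast
  then show "\<exists>A. countable A \<and> A \<subseteq> sets (completion M) \<and> \<Union>A = space (completion M) \<and>
      (\<forall>a\<in>A. emeasure (completion M) a \<noteq> \<infinity>)"
    by (intro exI[of _ A]) (auto simp: subset_eq)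
qed

lemma sigma_finite_bessel_struve_measure: "sigma_finite_measure (bessel_struve_measure \<alpha>)"
proof -
  interpret lebesgue: sigma_finite_measure "lebesgue :: real measure"
    by (intro sigma_finite_completion lborel.sigma_finite_measure_axioms)
  show ?thesis
    unfolding bessel_struve_measure_def
    \<comment> \<open>The density is \<open>ennreal\<close> of a real number, hence finite
      everywhere.\<close>
    by (subst lebesgue.sigma_finite_iff_density_finite) (auto intro: measurable_completion)
qed

text \<open>The product \<open>g x * f y\<close> is integrable on the product space, and the kernel
  enlarges it by at most the factor \<open>B\<close>. Both iterated integrals therefore equal the
  same double integral.\<close>

lemma Fubini_bounded_kernel:
  fixes K :: "'a \<Rightarrow> 'a \<Rightarrow> complex" and f g :: "'a \<Rightarrow> real"
  assumes "sigma_finite_measure M"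
    and K [measurable]: "case_prod K \<in> borel_measurable (M \<Otimes>\<^sub>M M)" and B: "\<And>x y. norm (K x y) \<le> B"
    and f: "integrable M f" and g: "integrable M g"
  shows "(\<integral>x. (\<integral>y. of_real (f y) * K x y \<partial>M) * of_real (g x) \<partial>M) =
         (\<integral>y. (\<integral>x. of_real (g x) * K x y \<partial>M) * of_real (f y) \<partial>M)"
proof -
  interpret sigma_finite_measure M by fact
  interpret pair_sigma_finite M M ..
  have [measurable]: "f \<in> borel_measurable M" "g \<in> borel_measurable M"
    using f g by auto
  have "integrable (M \<Otimes>\<^sub>M M) (\<lambda>(x, y). g x * f y)"
  proof (rule Fubini_integrable)
    show "integrable M (\<lambda>x. \<integral>y. norm (case (x, y) of (x, y) \<Rightarrow> g x * f y) \<partial>M)"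
      using f g by (simp add: abs_mult)
  qed (use f g in auto)
  then have "integrable (M \<Otimes>\<^sub>M M) (\<lambda>p. B * (case p of (x, y) \<Rightarrow> g x * f y))"
    by simp
  then have "integrable (M \<Otimes>\<^sub>M M) (\<lambda>(x, y). of_real (f y) * K x y * of_real (g x))"
  proof (rule Bochner_Integration.integrable_bound)
    have "norm (of_real (f y) * K x y * of_real (g x)) \<le> norm (B * (g x * f y))" for x y
    proof -
      have "norm (K x y) * \<bar>g x * f y\<bar> \<le> \<bar>B\<bar> * \<bar>g x * f y\<bar>"
        using B[of x y] by (intro mult_right_mono) auto
      then show ?thesis
        by (simp add: norm_mult abs_mult mult_ac)
    qed
    then show "AE p in M \<Otimes>\<^sub>M M. norm (case p of (x, y) \<Rightarrow> of_real (f y) * K x y * of_real (g x))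
        \<le> norm (B * (case p of (x, y) \<Rightarrow> g x * f y))"
      by auto
  qed measurable
  from Fubini_integral[OF this, symmetric]
  have "(\<integral>x. (\<integral>y. of_real (f y) * K x y * of_real (g x) \<partial>M) \<partial>M) =
      (\<integral>y. (\<integral>x. of_real (g x) * K x y * of_real (f y) \<partial>M) \<partial>M)"
    by (simp add: mult_ac)
  then show ?thesis
    by simp
qed

theorem theorem2p2:
  fixes \<alpha> :: real and f g :: "real \<Rightarrow> real"
  assumes "\<alpha> > - 1 / 2"
    and "f \<in> bessel_struve_L1 \<alpha>" and "g \<in> bessel_struve_L1 \<alpha>"
  shows "(\<integral>x. bessel_struve_transform \<alpha> f x * of_real (g x) \<partial>bessel_struve_measure \<alpha>) =
         (\<integral>x. bessel_struve_transform \<alpha> g x * of_real (f x) \<partial>bessel_struve_measure \<alpha>)"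
proof -
  let ?M = "bessel_struve_measure \<alpha>"
  obtain K B where K [measurable]: "K \<in> borel_measurable borel" and B: "\<And>s. norm (K s) \<le> B"
    and kernel: "\<And>x y. bessel_struve_kernel \<alpha> (- \<i> * of_real x) y = K (x * y)"
    using bessel_struve_kernel_bounded_measurable[OF assms(1)] by metis
  \<comment> \<open>\<open>?M\<close> carries the Lebesgue sets. Passing through the identity into
    \<open>borel\<close> makes \<open>x * y\<close> measurable on the product, and \<open>K\<close>
    is Borel, so the composite is measurable.\<close>
  have [measurable]: "(\<lambda>x. x) \<in> borel_measurable ?M"
    unfolding bessel_struve_measure_def by (simp add: measurable_completion)
  have "(\<lambda>(x, y). K (x * y)) \<in> borel_measurable (?M \<Otimes>\<^sub>M ?M)"
    by measurable
  then have "(\<integral>x. (\<integral>y. of_real (f y) * K (x * y) \<partial>?M) * of_real (g x) \<partial>?M) =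
      (\<integral>y. (\<integral>x. of_real (g x) * K (x * y) \<partial>?M) * of_real (f y) \<partial>?M)"
    using assms B
    by (intro Fubini_bounded_kernel[where K = "\<lambda>x y. K (x * y)"] sigma_finite_bessel_struve_measure)
      (auto simp: bessel_struve_L1_def)
  \<comment> \<open>The transform of \<open>g\<close> at \<open>y\<close> contains
    \<open>K (y * x)\<close>; symmetry of the product identifies it with
    \<open>K (x * y)\<close>.\<close>
  then show ?thesis
    unfolding bessel_struve_transform_def kernel by (simp only: mult.commute)
qed

end
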